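(* Let $f\colon A\to B$ be a surjective homomorphism of skew braces (an extension). Then $f$ is a central extension with respect to the subvariety $\mathsf{Grp}$ of the variety $\mathsf{SKB}$ of skew braces if and only if $[\operatorname{Ker}(f),A]_{\mathsf{Grp}}=0$.
   Context: A skew brace is a triple $(A,+,\circ)$ where $(A,+)$ and $(A,\circ)$ are groups such that $a\circ(b+c)=a\circ b-a+a\circ c$ for all $a,b,c\in A$; the common identity is $0$. Put $a*b=-a+a\circ b-b$. An ideal of $A$ is a normal subgroup $I$ of $(A,+)$ with $a*x, x*a\in I$ for all $a\in A$, $x\in I$. $\mathsf{Grp}$ is identified with the full subcategory of $\mathsf{SKB}$ consisting of the skew braces whose two operations $+$ and $\circ$ coincide. The inclusion $\mathsf{Grp}\to\mathsf{SKB}$ has a left adjoint, sending $A$ to $A/(A*A)$, where $A*A$ is the subgroup of $(A,+)$ generated by all $a*b$, $a,b\in A$ (it is an ideal, the smallest one whose quotient lies in $\mathsf{Grp}$). Write $R(A)=A*A$ for the kernel of the unit $A\to A/(A*A)$; $R$ is an endofunctor of $\mathsf{SKB}$, acting on morphisms by restriction. For an extension $f\colon A\to B$, let $A\times_B A=\{(a_1,a_2)\in A\times A\mid f(a_1)=f(a_2)\}$ with first and second projections $s,t\colon A\times_B A\to A$. The extension is central with respect to $\mathsf{Grp}$ if $R(s)=R(t)$, i.e. $s$ and $t$ agree on $R(A\times_B A)$. For an ideal $I$ of $A$, $[I,A]_{\mathsf{Grp}}$ is the subgroup of $(A,+)$ generated by $\{a*b,\ b*a,\ c+b*a-c\mid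 a\in I,\ b,c\in A\}$. *)

theory Defs
  imports "HOL-Algebra.Algebra"
begin

text \<open>
  The two operations of a skew brace are carried by the library's ring record: \<open>\<oplus>\<close>, \<open>\<zero>\<close>, \<open>\<ominus>\<close>
  belong to the (in general non-abelian) group \<open>(A,+)\<close>, while \<open>\<otimes>\<close>, \<open>\<one>\<close> belong to \<open>(A,\<circ>)\<close>.
  No ring axiom is assumed.
\<close>

locale skew_brace =
  fixes A :: "('a, 'm) ring_scheme" (structure)
  assumes add_group: "group (add_monoid A)"
    and circ_group: "group A"
    and brace_distrib:
      "\<lbrakk>a \<in> carrier A; b \<in> carrier A; c \<in> carrier A\<rbrakk>
        \<Longrightarrow> a \<otimes> (b \<oplus> c) = (a \<otimes> b \<ominus> a) \<oplus> a \<otimes> c"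

definition skew_brace_hom ::
    "('a, 'm) ring_scheme \<Rightarrow> ('b, 'n) ring_scheme \<Rightarrow> ('a \<Rightarrow> 'b) set" where
  "skew_brace_hom A B = hom (add_monoid A) (add_monoid B) \<inter> hom A B"

definition skew_brace_extension ::
    "('a, 'm) ring_scheme \<Rightarrow> ('b, 'n) ring_scheme \<Rightarrow> ('a \<Rightarrow> 'b) \<Rightarrow> bool" where
  "skew_brace_extension A B f \<longleftrightarrow> f \<in> skew_brace_hom A B \<and> f ` carrier A = carrier B"

definition star :: "('a, 'm) ring_scheme \<Rightarrow> 'a \<Rightarrow> 'a \<Rightarrow> 'a" where
  "star A a b = (\<ominus>\<^bsub>A\<^esub> a) \<oplus>\<^bsub>A\<^esub> (a \<otimes>\<^bsub>A\<^esub> b) \<ominus>\<^bsub>A\<^esub> b"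

definition skew_brace_ideal :: "'a set \<Rightarrow> ('a, 'm) ring_scheme \<Rightarrow> bool" where
  "skew_brace_ideal I A \<longleftrightarrow> I \<lhd> add_monoid A \<and>
     (\<forall>a\<in>carrier A. \<forall>x\<in>I. star A a x \<in> I \<and> star A x a \<in> I)"

text \<open>
  Membership in the subvariety \<open>Grp\<close>, and the kernel \<open>R(A) = A * A\<close> of the unit of the
  reflection onto it. \<open>Grp_radical_map\<close> is the action of \<open>R\<close> on morphisms.
\<close>

definition in_Grp :: "('a, 'm) ring_scheme \<Rightarrow> bool" where
  "in_Grp A \<longleftrightarrow> (\<forall>a\<in>carrier A. \<forall>b\<in>carrier A. a \<otimes>\<^bsub>A\<^esub> b = a \<oplus>\<^bsub>A\<^esub> b)"

definition Grp_radical :: "('a, 'm) ring_scheme \<Rightarrow> 'a set" where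
  "Grp_radical A =
     generate (add_monoid A) {star A a b | a b. a \<in> carrier A \<and> b \<in> carrier A}"

definition Grp_radical_map :: "('a, 'm) ring_scheme \<Rightarrow> ('a \<Rightarrow> 'b) \<Rightarrow> 'a \<Rightarrow> 'b" where
  "Grp_radical_map A f = restrict f (Grp_radical A)"

definition kernel_pair :: "('a, 'm) ring_scheme \<Rightarrow> ('a \<Rightarrow> 'b) \<Rightarrow> ('a \<times> 'a) ring" where
  "kernel_pair A f = (RDirProd A A)
     \<lparr>carrier := {(a1, a2). a1 \<in> carrier A \<and> a2 \<in> carrier A \<and> f a1 = f a2}\<rparr>"

definition Grp_central :: "('a, 'm) ring_scheme \<Rightarrow> ('a \<Rightarrow> 'b) \<Rightarrow> bool" where
  "Grp_central A f \<longleftrightarrow>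
     Grp_radical_map (kernel_pair A f) fst = Grp_radical_map (kernel_pair A f) snd"

definition Grp_commutator :: "'a set \<Rightarrow> ('a, 'm) ring_scheme \<Rightarrow> 'a set" where
  "Grp_commutator I A = generate (add_monoid A)
     ({star A a b | a b. a \<in> I \<and> b \<in> carrier A}
      \<union> {star A b a | a b. a \<in> I \<and> b \<in> carrier A}
      \<union> {c \<oplus>\<^bsub>A\<^esub> star A b a \<ominus>\<^bsub>A\<^esub> c | a b c. a \<in> I \<and> b \<in> carrier A \<and> c \<in> carrier A})"


context skew_brace
begin

sublocale add: group "add_monoid A"
  rewrites "carrier (add_monoid A) = carrier A"
    and "monoid.mult (add_monoid A) = add A"
    and "monoid.one (add_monoid A) = \<zero>\<^bsub>A\<^esub>"
    and "m_inv (add_monoid A) = a_inv A"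
  by (auto simp: add_group a_inv_def)

sublocale circ: group A
  by (rule circ_group)

lemma zero_eq_one: "\<zero> = \<one>"
proof -
  have "\<one> \<otimes> (\<zero> \<oplus> \<zero>) = (\<one> \<otimes> \<zero> \<ominus> \<one>) \<oplus> \<one> \<otimes> \<zero>"
    by (rule brace_distrib) auto
  then have "\<zero> = \<ominus> \<one>"
    by (simp add: a_minus_def)
  then show ?thesis
    by (metis add.inv_inv add.inv_one circ.one_closed)
qed

end

lemma kernel_pair_simps:
  "carrier (kernel_pair A f) = {(a1, a2). a1 \<in> carrier A \<and> a2 \<in> carrier A \<and> f a1 = f a2}"
  "(a1, a2) \<otimes>\<^bsub>kernel_pair A f\<^esub> (b1, b2) = (a1 \<otimes>\<^bsub>A\<^esub> b1, a2 \<otimes>\<^bsub>A\<^esub> b2)"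
  "(a1, a2) \<oplus>\<^bsub>kernel_pair A f\<^esub> (b1, b2) = (a1 \<oplus>\<^bsub>A\<^esub> b1, a2 \<oplus>\<^bsub>A\<^esub> b2)"
  "\<zero>\<^bsub>kernel_pair A f\<^esub> = (\<zero>\<^bsub>A\<^esub>, \<zero>\<^bsub>A\<^esub>)"
  "\<one>\<^bsub>kernel_pair A f\<^esub> = (\<one>\<^bsub>A\<^esub>, \<one>\<^bsub>A\<^esub>)"
  by (auto simp: kernel_pair_def RDirProd_def DirProd_def monoid.defs)

locale skew_brace_hom_pair = A: skew_brace A + B: skew_brace B
  for A :: "('a, 'm) ring_scheme" and B :: "('b, 'n) ring_scheme" +
  fixes f :: "'a \<Rightarrow> 'b"
  assumes hom: "f \<in> skew_brace_hom A B"
begin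

sublocale add: group_hom "add_monoid A" "add_monoid B" f
  rewrites "carrier (add_monoid A) = carrier A"
    and "monoid.mult (add_monoid A) = add A"
    and "monoid.one (add_monoid A) = \<zero>\<^bsub>A\<^esub>"
    and "m_inv (add_monoid A) = a_inv A"
    and "carrier (add_monoid B) = carrier B"
    and "monoid.mult (add_monoid B) = add B"
    and "monoid.one (add_monoid B) = \<zero>\<^bsub>B\<^esub>"
    and "m_inv (add_monoid B) = a_inv B"
  using hom A.add_group B.add_group
  by (auto simp: a_inv_def skew_brace_hom_def group_hom_def group_hom_axioms_def)

sublocale circ: group_hom A B f
  using hom A.circ_group B.circ_group
  by (auto simp: skew_brace_hom_def group_hom_def group_hom_axioms_def)

lemma kernel_pair_skew_brace: "skew_brace (kernel_pair A f)"
proof -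
  let ?P = "kernel_pair A f"
  have ag: "group (add_monoid ?P)"
  proof (rule groupI)
    fix x assume "x \<in> carrier (add_monoid ?P)"
    then obtain a b where "x = (a, b)" "a \<in> carrier A" "b \<in> carrier A" "f a = f b"
      by (auto simp: kernel_pair_simps)
    then show "\<exists>y\<in>carrier (add_monoid ?P). y \<otimes>\<^bsub>add_monoid ?P\<^esub> x = \<one>\<^bsub>add_monoid ?P\<^esub>"
      by (intro bexI[of _ "(\<ominus>\<^bsub>A\<^esub> a, \<ominus>\<^bsub>A\<^esub> b)"]) (auto simp: kernel_pair_simps)
  qed (auto simp: kernel_pair_simps A.add.m_assoc)
  have cg: "group ?P"
  proof (rule groupI)
    fix x assume "x \<in> carrier ?P"
    then obtain a b where "x = (a, b)" "a \<in> carrier A" "b \<in> carrier A" "f a = f b"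
      by (auto simp: kernel_pair_simps)
    then show "\<exists>y\<in>carrier ?P. y \<otimes>\<^bsub>?P\<^esub> x = \<one>\<^bsub>?P\<^esub>"
      by (intro bexI[of _ "(inv\<^bsub>A\<^esub> a, inv\<^bsub>A\<^esub> b)"]) (auto simp: kernel_pair_simps)
  qed (auto simp: kernel_pair_simps A.circ.m_assoc)
  have inv: "\<ominus>\<^bsub>?P\<^esub> (a, b) = (\<ominus>\<^bsub>A\<^esub> a, \<ominus>\<^bsub>A\<^esub> b)"
    if "a \<in> carrier A" "b \<in> carrier A" "f a = f b" for a b
    unfolding a_inv_def[of ?P]
    by (rule group.inv_equality[OF ag]) (use that in \<open>auto simp: kernel_pair_simps\<close>)
  show ?thesis
    by (rule skew_brace.intro[OF ag cg])
       (auto simp: kernel_pair_simps a_minus_def inv A.brace_distrib)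
qed

lemma star_hom:
  assumes "a \<in> carrier A" "b \<in> carrier A"
  shows "f (star A a b) = star B (f a) (f b)"
  using assms by (simp add: star_def a_minus_def)

lemma Grp_radical_sub_kernel:
  assumes "in_Grp B"
  shows "Grp_radical A \<subseteq> a_kernel A B f"
proof -
  have "star B x y = \<zero>\<^bsub>B\<^esub>" if "x \<in> carrier B" "y \<in> carrier B" for x y
    using that assms
    by (simp add: in_Grp_def star_def a_minus_def B.add.m_assoc[symmetric])
  then have "star A a b \<in> kernel (add_monoid A) (add_monoid B) f"
    if "a \<in> carrier A" "b \<in> carrier A" for a b
    using that star_hom[OF that] by (auto simp: kernel_def) (auto simp: star_def a_minus_def)
  then show ?thesis
    unfolding Grp_radical_def a_kernel_def
    by (intro A.add.generate_subgroup_incl add.subgroup_kernel) auto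
qed

lemma a_kernel_ideal: "skew_brace_ideal (a_kernel A B f) A"
proof -
  have s0: "star B x \<zero>\<^bsub>B\<^esub> = \<zero>\<^bsub>B\<^esub>" "star B \<zero>\<^bsub>B\<^esub> x = \<zero>\<^bsub>B\<^esub>" if "x \<in> carrier B" for x
    using that by (simp_all add: star_def a_minus_def B.zero_eq_one)
      (simp_all add: B.zero_eq_one[symmetric])
  have cl: "star A a b \<in> carrier A" if "a \<in> carrier A" "b \<in> carrier A" for a b
    using that by (simp add: star_def a_minus_def)
  show ?thesis
    unfolding skew_brace_ideal_def a_kernel_def
    using add.normal_kernel by (auto simp: kernel_def star_hom s0 cl)
qed

end

end

theory Submission
  imports Defs
begin

text \<open>
  Centrality means that \<open>a * b\<close> depends only on \<open>f a\<close> and \<open>f b\<close>. If it does, replacing an element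
  of the kernel by \<open>0\<close> kills every generator of the commutator. Conversely, a trivial commutator
  says that \<open>\<circ>\<close> and \<open>+\<close> agree as soon as one argument lies in the kernel; so if \<open>a' = k + a\<close> and
  \<open>b' = b + l\<close> with \<open>k, l\<close> in the kernel, then
  \<open>a' \<circ> b' = k \<circ> a \<circ> b \<circ> l = k + a \<circ> b + l\<close>, whence \<open>a' * b' = a * b\<close>.
\<close>

context skew_brace
begin

lemma star_closed:
  assumes "a \<in> carrier A" "b \<in> carrier A"
  shows "star A a b \<in> carrier A"
  using assms by (simp add: star_def a_minus_def)

lemma star_zero:
  assumes "a \<in> carrier A"
  shows "star A a \<zero> = \<zero>" "star A \<zero> a = \<zero>"
  \<comment> \<open>The shared identity is first written \<open>\<one>\<close>, so that the
    \<open>\<otimes>\<close>-terms collapse, and then \<open>\<zero>\<close> again for the additive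
    laws.\<close>
  using assms by (simp_all add: star_def a_minus_def zero_eq_one)
    (simp_all add: zero_eq_one[symmetric])

text \<open>The star is the defect between the two operations; in this form a trivial commutator
  feeds \<open>star_translate\<close>.\<close>

lemma star_eq_zero_iff:
  assumes "a \<in> carrier A" "b \<in> carrier A"
  shows "star A a b = \<zero> \<longleftrightarrow> a \<otimes> b = a \<oplus> b"
proof
  assume "star A a b = \<zero>"
  then have "a \<oplus> (star A a b \<oplus> b) = a \<oplus> b"
    using assms by simp
  then show "a \<otimes> b = a \<oplus> b"
    using assms by (simp add: star_def a_minus_def add.m_assoc add.inv_solve_left')
next
  assume "a \<otimes> b = a \<oplus> b"
  then show "star A a b = \<zero>"
    using assms by (simp add: star_def a_minus_def add.m_assoc[symmetric])
qed

lemma star_translate: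
  assumes "a \<in> carrier A" "b \<in> carrier A" "k \<in> carrier A" "l \<in> carrier A"
    and "\<And>x. x \<in> carrier A \<Longrightarrow> k \<otimes> x = k \<oplus> x"
    and "\<And>x. x \<in> carrier A \<Longrightarrow> x \<otimes> l = x \<oplus> l"
  shows "star A (k \<oplus> a) (b \<oplus> l) = star A a b"
proof -
  have "(k \<oplus> a) \<otimes> (b \<oplus> l) = (k \<otimes> a) \<otimes> (b \<otimes> l)"
    using assms by simp
  also have "\<dots> = k \<otimes> ((a \<otimes> b) \<otimes> l)"
    using assms(1-4) by (simp add: circ.m_assoc)
  also have "\<dots> = k \<oplus> ((a \<otimes> b) \<oplus> l)"
    using assms by simp
  \<comment> \<open>Negating \<open>b \<oplus> l\<close> reverses its order, so \<open>l\<close>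
    meets \<open>\<ominus> l\<close> just as \<open>\<ominus> k\<close> meets
    \<open>k\<close>.\<close>
  finally have "star A (k \<oplus> a) (b \<oplus> l)
      = \<ominus> a \<oplus> (\<ominus> k \<oplus> (k \<oplus> (a \<otimes> b \<oplus> (l \<oplus> (\<ominus> l \<oplus> \<ominus> b)))))"
    using assms(1-4)
    by (simp add: star_def a_minus_def add.inv_mult_group add.m_assoc)
  also have "\<dots> = star A a b"
    using assms(1-4) by (simp add: star_def a_minus_def add.m_assoc[symmetric])
  finally show ?thesis .
qed

text \<open>A generated subgroup is trivial exactly when all its generators are; the conjugates in
  the third family vanish together with \<open>star A b a\<close>.\<close>

lemma Grp_commutator_trivial_iff:
  "Grp_commutator I A = {\<zero>}
    \<longleftrightarrow> (\<forall>a\<in>I. \<forall>b\<in>carrier A. star A a b = \<zero> \<and> star A b a = \<zero>)" (is "?L \<longleftrightarrow> ?R")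
proof
  let ?S = "{star A a b | a b. a \<in> I \<and> b \<in> carrier A}
      \<union> {star A b a | a b. a \<in> I \<and> b \<in> carrier A}
      \<union> {c \<oplus> star A b a \<ominus> c | a b c. a \<in> I \<and> b \<in> carrier A \<and> c \<in> carrier A}"
  have gen: "Grp_commutator I A = generate (add_monoid A) ?S"
    by (simp add: Grp_commutator_def)
  {
    assume ?L
    then have "?S \<subseteq> {\<zero>}"
      using generate.incl[of _ ?S "add_monoid A"] by (simp only: gen subsetI)
    then show ?R
      by blast
  }
  assume R: ?R
  have "?S \<subseteq> {\<zero>}"
    using R by (auto simp: a_minus_def)
  moreover have "subgroup {\<zero>} (add_monoid A)"
    using add.triv_subgroup by simp
  ultimately have "Grp_commutator I A \<subseteq> {\<zero>}"
    unfolding gen by (rule add.generate_subgroup_incl)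
  moreover have "\<zero> \<in> Grp_commutator I A"
    unfolding gen using generate.one[of "add_monoid A"] by simp
  ultimately show ?L by blast
qed

end

context group_hom
begin

text \<open>The elements on which two homomorphisms agree form a subgroup. For the projections of
  the kernel pair this reduces centrality to the generators of the radical.\<close>

lemma eq_on_generate:
  assumes "group_hom G H g" "S \<subseteq> carrier G" "\<And>x. x \<in> S \<Longrightarrow> h x = g x"
    and "x \<in> generate G S"
  shows "h x = g x"
proof -
  interpret g: group_hom G H g by fact
  show ?thesis
    using assms(4)
  proof induction
    \<comment> \<open>\<open>generate\<close> inverts generators only, so this case rests on
      agreement on \<open>S\<close>.\<close>
    case (inv x)
    then show ?case using assms(2,3) by (metis hom_inv g.hom_inv subsetD)
  next
    case (eng x y)
    then show ?case using G.generate_in_carrier[OF assms(2)] by simp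
  qed (auto simp: assms(3))
qed

end

context skew_brace_hom_pair
begin

lemma kernel_pair_projections:
  "skew_brace_hom_pair (kernel_pair A f) A fst"
  "skew_brace_hom_pair (kernel_pair A f) A snd"
  using kernel_pair_skew_brace A.skew_brace_axioms
  by (auto simp: skew_brace_hom_pair_def skew_brace_hom_pair_axioms_def skew_brace_hom_def
      hom_def kernel_pair_simps)

text \<open>Both projections of the kernel pair preserve \<open>star\<close>, so comparing them on a
  generator of its radical compares the star of the first components with that of the
  second.\<close>

lemma Grp_central_iff:
  "Grp_central A f \<longleftrightarrow>
    (\<forall>a\<in>carrier A. \<forall>a'\<in>carrier A. \<forall>b\<in>carrier A. \<forall>b'\<in>carrier A.
      f a = f a' \<longrightarrow> f b = f b' \<longrightarrow> star A a b = star A a' b')" (is "_ \<longleftrightarrow> ?R")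
proof -
  let ?P = "kernel_pair A f"
  let ?S = "{star ?P p q | p q. p \<in> carrier ?P \<and> q \<in> carrier ?P}"
  interpret s: skew_brace_hom_pair ?P A fst by (rule kernel_pair_projections)
  interpret t: skew_brace_hom_pair ?P A snd by (rule kernel_pair_projections)
  have S: "?S \<subseteq> carrier (add_monoid ?P)"
    using s.A.star_closed by auto
  \<comment> \<open>Both restrictions are \<open>undefined\<close> off the radical, so only their
    values on it matter.\<close>
  have "Grp_central A f \<longleftrightarrow> (\<forall>x\<in>Grp_radical ?P. fst x = snd x)"
    by (auto simp: Grp_central_def Grp_radical_map_def restrict_def fun_eq_iff)
  also have "\<dots> \<longleftrightarrow> (\<forall>x\<in>?S. fst x = snd x)"
    unfolding Grp_radical_def
    using group_hom.eq_on_generate[OF s.add.group_hom_axioms t.add.group_hom_axioms S]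
      generate.incl[of _ ?S "add_monoid ?P"] by blast
  also have "\<dots> \<longleftrightarrow> (\<forall>p\<in>carrier ?P. \<forall>q\<in>carrier ?P.
      fst (star ?P p q) = snd (star ?P p q))"
    by blast
  also have "\<dots> \<longleftrightarrow> (\<forall>p\<in>carrier ?P. \<forall>q\<in>carrier ?P.
      star A (fst p) (fst q) = star A (snd p) (snd q))"
    by (simp only: s.star_hom t.star_hom cong: ball_cong)
  also have "\<dots> \<longleftrightarrow> ?R"
    by (auto simp: kernel_pair_simps)
  finally show ?thesis .
qed

end

theorem proposition3p5:
  fixes A :: "('a, 'm) ring_scheme" and B :: "('b, 'n) ring_scheme" and f :: "'a \<Rightarrow> 'b"
  assumes "skew_brace A" and "skew_brace B"
    and "skew_brace_extension A B f"
  shows "Grp_central A f \<longleftrightarrow> Grp_commutator (a_kernel A B f) A = {\<zero>\<^bsub>A\<^esub>}"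
proof -
  interpret skew_brace_hom_pair A B f
    using assms
    by (simp add: skew_brace_hom_pair_def skew_brace_hom_pair_axioms_def skew_brace_extension_def)
  let ?K = "a_kernel A B f"
  have K: "x \<in> ?K \<longleftrightarrow> x \<in> carrier A \<and> f x = \<zero>\<^bsub>B\<^esub>" for x
    by (auto simp: a_kernel_def kernel_def)
  have "Grp_central A f
      \<longleftrightarrow> (\<forall>k\<in>?K. \<forall>b\<in>carrier A. star A k b = \<zero>\<^bsub>A\<^esub> \<and> star A b k = \<zero>\<^bsub>A\<^esub>)"
    (is "_ \<longleftrightarrow> ?T")
  proof
    assume C: "Grp_central A f"
    show ?T
    proof (intro ballI)
      fix k b assume "k \<in> ?K" and b: "b \<in> carrier A"
      then have k: "k \<in> carrier A" "f k = f \<zero>\<^bsub>A\<^esub>"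
        using K by simp_all
      \<comment> \<open>Centrality is applied to \<open>(k, \<zero>)\<close> and
        \<open>(b, b)\<close>, which lie in the kernel pair.\<close>
      have "star A k b = star A \<zero>\<^bsub>A\<^esub> b" "star A b k = star A b \<zero>\<^bsub>A\<^esub>"
        using C k b unfolding Grp_central_iff by (metis A.add.one_closed)+
      then show "star A k b = \<zero>\<^bsub>A\<^esub> \<and> star A b k = \<zero>\<^bsub>A\<^esub>"
        using A.star_zero b by simp
    qed
  next
    assume T: ?T
    show "Grp_central A f"
      unfolding Grp_central_iff
    proof (intro ballI impI)
      fix a a' b b'
      assume car: "a \<in> carrier A" "a' \<in> carrier A" "b \<in> carrier A" "b' \<in> carrier A"
        and f: "f a = f a'" "f b = f b'"
      \<comment> \<open>Since \<open>\<oplus>\<close> need not commute, sides matter: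
        \<open>k\<close> splits off on the left and \<open>l\<close> on the right, so both end up at
        the outer ends of \<open>a' \<otimes> b'\<close>.\<close>
      define k l where "k = a' \<oplus>\<^bsub>A\<^esub> \<ominus>\<^bsub>A\<^esub> a" and "l = \<ominus>\<^bsub>A\<^esub> b \<oplus>\<^bsub>A\<^esub> b'"
      have kl: "k \<in> ?K" "l \<in> ?K"
        using car f by (simp_all add: K k_def l_def)
      then have kl_car: "k \<in> carrier A" "l \<in> carrier A"
        using K by simp_all
      have "k \<oplus>\<^bsub>A\<^esub> a = a'" "b \<oplus>\<^bsub>A\<^esub> l = b'"
        using car by (simp add: k_def A.add.m_assoc)
          (simp add: l_def car A.add.m_assoc[symmetric])
      \<comment> \<open>By \<open>?T\<close>, multiplying by \<open>k\<close> on the left or by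
        \<open>l\<close> on the right is addition.\<close>
      moreover have "star A (k \<oplus>\<^bsub>A\<^esub> a) (b \<oplus>\<^bsub>A\<^esub> l) = star A a b"
        using T kl kl_car car by (intro A.star_translate) (auto simp: A.star_eq_zero_iff)
      ultimately show "star A a b = star A a' b'"
        by simp
    qed
  qed
  also have "\<dots> \<longleftrightarrow> Grp_commutator ?K A = {\<zero>\<^bsub>A\<^esub>}"
    by (rule A.Grp_commutator_trivial_iff[symmetric])
  finally show ?thesis .
qed

end
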